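(* Let $V\subset\mathbb{R}^n$ be a tropical prevariety given by a system $A$ of tropical polynomials in $n$ variables. Then one can add $2n$ extra variables and $4n$ extra tropical polynomials (in the resulting $3n$ variables) such that the system $B$, consisting of $A$ together with the added polynomials, determines a compact tropical prevariety $W\subset\mathbb{R}^{3n}$ that is homotopy equivalent to $V$.
   Context: A tropical polynomial $f$ in $n$ variables is given by a nonempty finite set of tropical monomials $Q_j(x)=a_j+i_{j1}x_1+\cdots+i_{jn}x_n$ with $a_j\in\mathbb{R}$ and pairwise distinct exponent vectors $(i_{j1},\dots,i_{jn})\in\mathbb{Z}_{\ge 0}^n$; $f(x)=\min_j Q_j(x)$. Monomials may be missing from $f$ (i.e. have coefficient $\infty$). A point $x\in\mathbb{R}^n$ is a tropical zero of $f$ if $\min_j Q_j(x)$ is attained for at least two different $j$. The tropical prevariety given by a finite system of tropical polynomials in $n$ variables is the set of all $x\in\mathbb{R}^n$ that are tropical zeros of every polynomial of the system. The polynomials of $A$ are regarded as polynomials in $3n$ variables not involving the $2n$ new variables. *)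

theory Defs
  imports "HOL-Analysis.Abstract_Euclidean_Space" "HOL-Analysis.Homotopy"
begin

text \<open>
  The \<open>n\<close> variables are indexed by \<open>0, \<dots>, n - 1\<close>. As in \<^const>\<open>Euclidean_space\<close>, a point of
  \<open>\<real>\<^sup>n\<close> is a sequence that vanishes from index \<open>n\<close> on; exponent vectors are encoded in
  the same way. A polynomial in \<open>n\<close> variables is therefore literally also a polynomial in \<open>m\<close>
  variables for every \<open>m \<ge> n\<close>, one that does not involve the variables \<open>n, \<dots>, m - 1\<close>.
\<close>

text \<open>The monomial \<open>a + i\<^sub>0 x\<^sub>0 + \<dots>\<close> is the pair of its coefficient \<open>a\<close> and its exponent vector \<open>i\<close>.\<close>

type_synonym trop_monomial = "real \<times> (nat \<Rightarrow> nat)"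

type_synonym trop_poly = "trop_monomial set"

definition trop_poly_in :: "nat \<Rightarrow> trop_poly \<Rightarrow> bool" where
  "trop_poly_in n f \<longleftrightarrow>
     finite f \<and> f \<noteq> {} \<and> inj_on snd f \<and> (\<forall>Q\<in>f. \<forall>k\<ge>n. snd Q k = 0)"

definition monomial_eval :: "nat \<Rightarrow> trop_monomial \<Rightarrow> (nat \<Rightarrow> real) \<Rightarrow> real" where
  "monomial_eval n Q x = fst Q + (\<Sum>k<n. real (snd Q k) * x k)"

definition trop_eval :: "nat \<Rightarrow> trop_poly \<Rightarrow> (nat \<Rightarrow> real) \<Rightarrow> real" where
  "trop_eval n f x = Min ((\<lambda>Q. monomial_eval n Q x) ` f)"

definition trop_zero :: "nat \<Rightarrow> trop_poly \<Rightarrow> (nat \<Rightarrow> real) \<Rightarrow> bool" where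
  "trop_zero n f x \<longleftrightarrow>
     (\<exists>Q\<in>f. \<exists>Q'\<in>f. Q \<noteq> Q' \<and>
        monomial_eval n Q x = trop_eval n f x \<and> monomial_eval n Q' x = trop_eval n f x)"

definition trop_system :: "nat \<Rightarrow> trop_poly set \<Rightarrow> bool" where
  "trop_system n A \<longleftrightarrow> finite A \<and> (\<forall>f\<in>A. trop_poly_in n f)"

definition trop_prevariety :: "nat \<Rightarrow> trop_poly set \<Rightarrow> (nat \<Rightarrow> real) set" where
  "trop_prevariety n A = {x \<in> topspace (Euclidean_space n). \<forall>f\<in>A. trop_zero n f x}"

end

theory Submission
  imports Defs
begin

text \<open>
  Let \<open>M\<close> be the finite set of all monomials of \<open>A\<close>. Whether \<open>x\<close> lies in \<open>V\<close> depends only on how the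
  values \<open>Q x\<close> for \<open>Q \<in> M\<close> are ordered, so \<open>V\<close> is a union of closed cells of the arrangement of
  the hyperplanes \<open>Q = Q'\<close>. The proof shows that cutting \<open>V\<close> with a large cube does not change its
  homotopy type, and that the extra variables and polynomials can express the cutting.

  For the first part, choose one point in each open cell; this gives a finite set \<open>P\<close>. A point \<open>p \<in> P\<close>
  gets, at \<open>x\<close>, a continuous weight that is positive exactly when every strict inequality
  \<open>Q p < Q' p\<close> persists at \<open>x\<close>, that is, when \<open>p\<close> lies in the closure of the open cell of \<open>x\<close>.
  The weighted average \<open>r x\<close> of \<open>P\<close> then lies in the closed cell of \<open>x\<close>, which is convex, so the
  segments from \<open>x\<close> to \<open>r x\<close> move \<open>V\<close> inside itself (lemma \<open>cell_preserving_contraction\<close>). If the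
  cube \<open>[-R, R]\<^sup>n\<close> contains \<open>P\<close>, then it contains every \<open>r x\<close> and, being convex, it is also
  preserved by the motion. Hence \<open>V\<close> and \<open>K = V \<inter> [-R, R]\<^sup>n\<close> are homotopy equivalent.

  For the second part, each variable \<open>x\<close> gets two companions \<open>y\<close> and \<open>z\<close>. The polynomials
  \<open>min(x, y)\<close> and \<open>min(x, y, R)\<close> together say \<open>y = x \<le> R\<close>, while \<open>min(x + z, 0)\<close> and
  \<open>min(x + z, 0, x + R)\<close> say \<open>z = -x\<close> and \<open>x \<ge> -R\<close>; all exponents are nonnegative. So the new
  prevariety is the graph of \<open>x \<mapsto> (x, -x)\<close> over the compact set \<open>K\<close>.
\<close>

section \<open>Homotopy equivalence from a motion of a space into a subspace\<close>

text \<open>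
  The final map of the motion is a homotopy inverse of the inclusion of \<open>S\<close>: the motion itself, and
  its restriction to \<open>S\<close>, are the two homotopies. The points of \<open>S\<close> may move within \<open>S\<close>, so
  the final map need not be a retraction.
\<close>

lemma homotopy_equivalent_space_weak_deformation:
  fixes h :: "real \<times> 'a::topological_space \<Rightarrow> 'a"
  assumes cont: "continuous_on ({0..1} \<times> X) h"
    and "S \<subseteq> X"
    and X: "\<And>t x. t \<in> {0..1} \<Longrightarrow> x \<in> X \<Longrightarrow> h (t, x) \<in> X"
    and S: "\<And>t x. t \<in> {0..1} \<Longrightarrow> x \<in> S \<Longrightarrow> h (t, x) \<in> S"
    and start: "\<And>x. x \<in> X \<Longrightarrow> h (0, x) = x"
    and final: "\<And>x. x \<in> X \<Longrightarrow> h (1, x) \<in> S"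
  shows "top_of_set S homotopy_equivalent_space top_of_set X"
proof -
  have motion: "homotopic_with_canon (\<lambda>_. True) T T id (\<lambda>x. h (1, x))"
    if "T \<subseteq> X" and "\<And>t x. t \<in> {0..1} \<Longrightarrow> x \<in> T \<Longrightarrow> h (t, x) \<in> T" for T
  proof -
    have "continuous_on ({0..1} \<times> T) h"
      by (rule continuous_on_subset[OF cont]) (use that(1) in auto)
    moreover have "prod_topology (top_of_set {0..1}) (top_of_set T)
        = (top_of_set ({0..1} \<times> T) :: (real \<times> 'a) topology)"
      using subtopology_Times[of euclidean euclidean "{0..1::real}" T] by simp
    moreover have "h \<in> {0..1} \<times> T \<rightarrow> T"
      using that(2) by blast
    ultimately have "continuous_map (prod_topology (top_of_set {0..1}) (top_of_set T)) (top_of_set T) h"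
      by (metis continuous_map_subtopology_eu)
    moreover have "\<forall>x\<in>T. h (0, x) = id x"
      using that(1) start by auto
    ultimately show ?thesis
      by (subst homotopic_with) auto
  qed
  have "continuous_on X (\<lambda>x. h (1, x))"
    by (rule continuous_on_compose2[OF cont]) (auto intro!: continuous_intros)
  then have "continuous_map (top_of_set X) (top_of_set S) (\<lambda>x. h (1, x))"
    using final by auto
  moreover have "continuous_map (top_of_set S) (top_of_set X) id"
    using \<open>S \<subseteq> X\<close> by auto
  moreover have "homotopic_with_canon (\<lambda>_. True) S S (\<lambda>x. h (1, x)) id"
    "homotopic_with_canon (\<lambda>_. True) X X (\<lambda>x. h (1, x)) id"
    using motion[of S, THEN homotopic_with_symD] motion[of X, THEN homotopic_with_symD] \<open>S \<subseteq> X\<close> X S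
    by simp_all
  ultimately show ?thesis
    unfolding homotopy_equivalent_space_def
    by (intro exI[of _ id] exI[of _ "\<lambda>x. h (1, x)"]) (simp add: comp_def)
qed

section \<open>Contracting space along the cells of finitely many monomials\<close>

lemma continuous_on_monomial_eval [continuous_intros]:
  assumes "continuous_on S f"
  shows "continuous_on S (\<lambda>x. monomial_eval n Q (f x))"
  unfolding monomial_eval_def
  by (intro continuous_on_add continuous_on_sum continuous_on_mult continuous_on_const
      continuous_on_product_then_coordinatewise[OF assms])

lemma monomial_eval_average:
  assumes "sum u P = 1"
  shows "monomial_eval n Q (\<lambda>k. \<Sum>p\<in>P. u p * p k) = (\<Sum>p\<in>P. u p * monomial_eval n Q p)"
proof -
  have "(\<Sum>k<n. real (snd Q k) * (\<Sum>p\<in>P. u p * p k))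
      = (\<Sum>p\<in>P. u p * (\<Sum>k<n. real (snd Q k) * p k))"
    by (simp add: sum_distrib_left mult.left_commute sum.swap[of _ P])
  moreover have "fst Q = (\<Sum>p\<in>P. u p * fst Q)"
    using assms by (simp flip: sum_distrib_right)
  ultimately show ?thesis
    by (simp add: monomial_eval_def distrib_left sum.distrib)
qed

lemma monomial_eval_segment:
  "monomial_eval n Q (\<lambda>k. (1 - t) * x k + t * y k)
    = (1 - t) * monomial_eval n Q x + t * monomial_eval n Q y"
  by (simp add: monomial_eval_def algebra_simps sum.distrib sum_subtractf sum_distrib_left)

text \<open>
  Only finitely many orderings of the values of \<open>M\<close> occur, so finitely many points meet all open cells.
\<close>

lemma finite_cell_representatives:
  assumes "finite M"
  obtains P where "finite P" "P \<subseteq> S"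
    "\<And>x. x \<in> S \<Longrightarrow> \<exists>p\<in>P. \<forall>Q\<in>M. \<forall>Q'\<in>M.
       monomial_eval n Q p < monomial_eval n Q' p \<longleftrightarrow> monomial_eval n Q x < monomial_eval n Q' x"
proof -
  define pattern where
    "pattern x = {(Q, Q'). Q \<in> M \<and> Q' \<in> M \<and> monomial_eval n Q x < monomial_eval n Q' x}" for x
  have "pattern ` S \<subseteq> Pow (M \<times> M)"
    by (auto simp: pattern_def)
  then have "finite (pattern ` S)"
    using assms finite_subset by blast
  then obtain P where P: "P \<subseteq> S" "finite P" "pattern ` S = pattern ` P"
    using finite_subset_image[of "pattern ` S" pattern S] by blast
  show thesis
  proof (rule that[OF P(2,1)])
    fix x assume "x \<in> S"
    then obtain p where "p \<in> P" "pattern p = pattern x"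
      using P(3) by (metis imageE imageI)
    then show "\<exists>p\<in>P. \<forall>Q\<in>M. \<forall>Q'\<in>M.
       monomial_eval n Q p < monomial_eval n Q' p \<longleftrightarrow> monomial_eval n Q x < monomial_eval n Q' x"
      unfolding pattern_def set_eq_iff by (intro bexI[of _ p]) auto
  qed
qed

text \<open>
  The weight \<open>w p x\<close> below is continuous and is positive iff \<open>p\<close> lies in the closed cell of \<open>x\<close>. At
  every \<open>x\<close> some weight is positive, namely that of the representative of the open cell of \<open>x\<close>, so
  the weights can be normalized to \<open>u p x\<close>.
\<close>

lemma cell_preserving_average:
  assumes "finite M"
  obtains P u where "finite P" "P \<subseteq> topspace (Euclidean_space n)"
    "\<And>p. continuous_on (topspace (Euclidean_space n)) (u p)"
    "\<And>p x. 0 \<le> u p x"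
    "\<And>x. x \<in> topspace (Euclidean_space n) \<Longrightarrow> (\<Sum>p\<in>P. u p x) = (1::real)"
    "\<And>p x Q Q'. \<lbrakk>u p x \<noteq> 0; Q \<in> M; Q' \<in> M; monomial_eval n Q x \<le> monomial_eval n Q' x\<rbrakk>
       \<Longrightarrow> monomial_eval n Q p \<le> monomial_eval n Q' p"
proof -
  let ?E = "topspace (Euclidean_space n)"
  obtain P where P: "finite P" "P \<subseteq> ?E"
    "\<And>x. x \<in> ?E \<Longrightarrow> \<exists>p\<in>P. \<forall>Q\<in>M. \<forall>Q'\<in>M.
       monomial_eval n Q p < monomial_eval n Q' p \<longleftrightarrow> monomial_eval n Q x < monomial_eval n Q' x"
    using finite_cell_representatives[OF assms] by metis
  define w where "w p x = (\<Prod>Q\<in>M. \<Prod>Q'\<in>M. if monomial_eval n Q p < monomial_eval n Q' p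
     then max 0 (monomial_eval n Q' x - monomial_eval n Q x) else 1)" for p x
  have w_nonneg: "0 \<le> w p x" for p x
    unfolding w_def by (intro prod_nonneg) auto
  have w_support: "monomial_eval n Q p \<le> monomial_eval n Q' p"
    if "w p x \<noteq> 0" "Q \<in> M" "Q' \<in> M" "monomial_eval n Q x \<le> monomial_eval n Q' x" for p x Q Q'
  proof (rule ccontr)
    assume "\<not> monomial_eval n Q p \<le> monomial_eval n Q' p"
    then have "w p x = 0"
      unfolding w_def using assms that(2-4)
      by (intro prod_zero bexI[of _ Q'] bexI[of _ Q]) auto
    then show False
      using that(1) by contradiction
  qed
  have sum_pos: "0 < (\<Sum>p\<in>P. w p x)" if x: "x \<in> ?E" for x
  proof -
    obtain p where p: "p \<in> P" "\<forall>Q\<in>M. \<forall>Q'\<in>M.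
       monomial_eval n Q p < monomial_eval n Q' p \<longleftrightarrow> monomial_eval n Q x < monomial_eval n Q' x"
      using P(3)[OF x] by blast
    have "0 < w p x"
      unfolding w_def using p by (intro prod_pos) auto
    then show ?thesis
      using p(1) P(1) w_nonneg by (intro sum_pos2) auto
  qed
  have cont: "continuous_on ?E (w p)" for p
  proof -
    have "continuous_on ?E (\<lambda>x. if c then max 0 (monomial_eval n Q' x - monomial_eval n Q x) else 1)"
      for c Q Q'
      by (cases c) (auto intro!: continuous_intros)
    then show ?thesis
      unfolding w_def[abs_def] by (intro continuous_on_prod)
  qed
  show thesis
  proof (rule that[OF P(1,2), of "\<lambda>p x. w p x / (\<Sum>p\<in>P. w p x)"])
    show "continuous_on ?E (\<lambda>x. w p x / (\<Sum>p\<in>P. w p x))" for p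
      using sum_pos by (intro continuous_intros cont) force
    show "0 \<le> w p x / (\<Sum>p\<in>P. w p x)" for p x
      using w_nonneg by (simp add: sum_nonneg)
    show "(\<Sum>p\<in>P. w p x / (\<Sum>p\<in>P. w p x)) = 1" if "x \<in> ?E" for x
      using sum_pos[OF that] by (simp flip: sum_divide_distrib)
  qed (use w_support in auto)
qed

lemma abs_segment_le:
  fixes a b R t :: real
  assumes "\<bar>a\<bar> \<le> R" "\<bar>b\<bar> \<le> R" "t \<in> {0..1}"
  shows "\<bar>(1 - t) * a + t * b\<bar> \<le> R"
proof -
  have "\<bar>(1 - t) * a + t * b\<bar> \<le> (1 - t) * \<bar>a\<bar> + t * \<bar>b\<bar>"
    using assms(3) by (intro order_trans[OF abs_triangle_ineq]) (simp add: abs_mult)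
  also have "\<dots> \<le> R"
    using assms by (intro convex_bound_le) auto
  finally show ?thesis .
qed

text \<open>
  The last property says that the motion keeps every point in its closed cell. The number \<open>R\<close> bounds
  the coordinates of the representatives, whose averages are the endpoints of the motion.
\<close>

lemma cell_preserving_contraction:
  assumes "finite M"
  obtains R and h :: "real \<times> (nat \<Rightarrow> real) \<Rightarrow> nat \<Rightarrow> real" where
    "continuous_on ({0..1} \<times> topspace (Euclidean_space n)) h"
    "\<And>t x. t \<in> {0..1} \<Longrightarrow> x \<in> topspace (Euclidean_space n) \<Longrightarrow> h (t, x) \<in> topspace (Euclidean_space n)"
    "\<And>x. h (0, x) = x"
    "\<And>x k. x \<in> topspace (Euclidean_space n) \<Longrightarrow> k < n \<Longrightarrow> \<bar>h (1, x) k\<bar> \<le> R"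
    "\<And>t x k. \<lbrakk>t \<in> {0..1}; x \<in> topspace (Euclidean_space n); k < n; \<bar>x k\<bar> \<le> R\<rbrakk>
       \<Longrightarrow> \<bar>h (t, x) k\<bar> \<le> R"
    "\<And>t x Q Q'. \<lbrakk>t \<in> {0..1}; x \<in> topspace (Euclidean_space n); Q \<in> M; Q' \<in> M;
         monomial_eval n Q x \<le> monomial_eval n Q' x\<rbrakk>
       \<Longrightarrow> monomial_eval n Q (h (t, x)) \<le> monomial_eval n Q' (h (t, x))"
proof -
  let ?E = "topspace (Euclidean_space n)"
  obtain P u where P: "finite P" "P \<subseteq> ?E"
    and u_cont: "\<And>p. continuous_on ?E (u p)"
    and u_nonneg: "\<And>p x. 0 \<le> u p x"
    and u_sum: "\<And>x. x \<in> ?E \<Longrightarrow> (\<Sum>p\<in>P. u p x) = (1::real)"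
    and u_support: "\<And>p x Q Q'. \<lbrakk>u p x \<noteq> 0; Q \<in> M; Q' \<in> M;
         monomial_eval n Q x \<le> monomial_eval n Q' x\<rbrakk>
       \<Longrightarrow> monomial_eval n Q p \<le> monomial_eval n Q' p"
    by (rule cell_preserving_average[OF assms, of n]) (rule that)
  have "finite ((\<lambda>(p, k). \<bar>p k\<bar>) ` (P \<times> {..<n}))"
    using P by simp
  then obtain R where "\<And>y. y \<in> (\<lambda>(p, k). \<bar>p k\<bar>) ` (P \<times> {..<n}) \<Longrightarrow> y \<le> R"
    using bdd_above_finite unfolding bdd_above_def by metis
  then have R: "\<And>p k. p \<in> P \<Longrightarrow> k < n \<Longrightarrow> \<bar>p k\<bar> \<le> R"
    by fastforce
  define r where "r x k = (\<Sum>p\<in>P. u p x * p k)" for x k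
  define h where "h = (\<lambda>(t, x) k. (1 - t) * x k + t * r x k)"
  have h_apply: "h (t, x) = (\<lambda>k. (1 - t) * x k + t * r x k)" for t x
    by (simp add: h_def)
  have r_bound: "\<bar>r x k\<bar> \<le> R" if "x \<in> ?E" "k < n" for x k
  proof -
    have "\<bar>r x k\<bar> \<le> (\<Sum>p\<in>P. u p x * \<bar>p k\<bar>)"
      unfolding r_def using u_nonneg by (intro order_trans[OF sum_abs]) (simp add: abs_mult)
    also have "\<dots> \<le> (\<Sum>p\<in>P. u p x * R)"
      using R that u_nonneg by (intro sum_mono mult_left_mono) auto
    also have "\<dots> = R"
      using u_sum[OF that(1)] by (simp flip: sum_distrib_right)
    finally show ?thesis .
  qed
  have r_cell: "monomial_eval n Q (r x) \<le> monomial_eval n Q' (r x)"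
    if "x \<in> ?E" "Q \<in> M" "Q' \<in> M" "monomial_eval n Q x \<le> monomial_eval n Q' x" for x Q Q'
  proof -
    have "u p x * monomial_eval n Q p \<le> u p x * monomial_eval n Q' p" for p
      using u_support[of p x Q Q'] that u_nonneg[of p x]
      by (cases "u p x = 0") (auto intro: mult_left_mono)
    then show ?thesis
      unfolding r_def using u_sum[OF that(1)]
      by (simp add: monomial_eval_average sum_mono)
  qed
  have u_cont_snd: "continuous_on ({0..1} \<times> ?E) (\<lambda>y. u p (snd y))" for p
    by (rule continuous_on_compose2[OF u_cont continuous_on_snd[OF continuous_on_id]]) auto
  have coordinate_cont: "continuous_on ({0..1} \<times> ?E) (\<lambda>y. snd y k)" for k
    by (rule continuous_on_product_then_coordinatewise[OF continuous_on_snd[OF continuous_on_id]])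
  show thesis
  proof (rule that[of h R])
    show "continuous_on ({0..1} \<times> ?E) h"
      unfolding h_def r_def case_prod_unfold
      by (rule continuous_on_coordinatewise_then_product)
        (intro continuous_on_add continuous_on_mult continuous_on_diff continuous_on_sum
          continuous_on_const continuous_on_fst continuous_on_id coordinate_cont u_cont_snd)
    show "h (t, x) \<in> ?E" if "x \<in> ?E" for t x
    proof -
      have "r x i = 0" if "n \<le> i" for i
        unfolding r_def using P(2) that by (intro sum.neutral) (auto simp: topspace_Euclidean_space)
      then show ?thesis
        using that by (auto simp: h_apply topspace_Euclidean_space)
    qed
    show "h (0, x) = x" for x
      by (simp add: h_apply)
    show "\<bar>h (1, x) k\<bar> \<le> R" if "x \<in> ?E" "k < n" for x k
      using r_bound[OF that] by (simp add: h_apply)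
    show "\<bar>h (t, x) k\<bar> \<le> R" if "t \<in> {0..1}" "x \<in> ?E" "k < n" "\<bar>x k\<bar> \<le> R" for t x k
      using abs_segment_le[OF that(4) r_bound[OF that(2,3)] that(1)] by (simp add: h_apply)
    show "monomial_eval n Q (h (t, x)) \<le> monomial_eval n Q' (h (t, x))"
      if "t \<in> {0..1}" "x \<in> ?E" "Q \<in> M" "Q' \<in> M"
        "monomial_eval n Q x \<le> monomial_eval n Q' x" for t x Q Q'
      using that r_cell[OF that(2-5)]
      by (auto simp: h_apply monomial_eval_segment intro!: add_mono mult_left_mono)
  qed
qed

section \<open>Prevarieties inside a large cube\<close>

lemma trop_zero_iff:
  assumes "finite f"
  shows "trop_zero n f x \<longleftrightarrow> (\<exists>Q\<in>f. \<exists>Q'\<in>f. Q \<noteq> Q' \<and>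
    (\<forall>S\<in>f. monomial_eval n Q x \<le> monomial_eval n S x) \<and>
    (\<forall>S\<in>f. monomial_eval n Q' x \<le> monomial_eval n S x))"
proof -
  have "monomial_eval n Q x = trop_eval n f x \<longleftrightarrow>
      (\<forall>S\<in>f. monomial_eval n Q x \<le> monomial_eval n S x)" if "Q \<in> f" for Q
    unfolding trop_eval_def using assms that by (subst eq_Min_iff) auto
  then show ?thesis
    unfolding trop_zero_def by metis
qed

lemma closed_trop_zero:
  assumes "finite f"
  shows "closed {x. trop_zero n f x}"
proof -
  have "{x. trop_zero n f x} = (\<Union>Q\<in>f. \<Union>Q'\<in>f - {Q}. \<Inter>S\<in>f.
      {x. monomial_eval n Q x \<le> monomial_eval n S x} \<inter> {x. monomial_eval n Q' x \<le> monomial_eval n S x})"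
    unfolding trop_zero_iff[OF assms] by blast
  also have "closed \<dots>"
    using assms by (intro closed_UN closed_INT ballI closed_Int closed_Collect_le continuous_intros) auto
  finally show ?thesis .
qed

lemma closed_trop_prevariety:
  assumes "trop_system n A"
  shows "closed (trop_prevariety n A)"
proof -
  have "trop_prevariety n A = topspace (Euclidean_space n) \<inter> (\<Inter>f\<in>A. {x. trop_zero n f x})"
    by (auto simp: trop_prevariety_def)
  moreover have "closed (topspace (Euclidean_space n))"
    using closedin_Euclidean_imp_closed closedin_topspace by blast
  ultimately show ?thesis
    using assms closed_trop_zero
    by (auto simp: trop_system_def trop_poly_in_def intro!: closed_Int closed_INT)
qed

definition cube :: "nat \<Rightarrow> real \<Rightarrow> (nat \<Rightarrow> real) set" where
  "cube n R = {x. (\<forall>k<n. \<bar>x k\<bar> \<le> R) \<and> (\<forall>k\<ge>n. x k = 0)}"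

lemma compact_cube: "compact (cube n R)"
proof -
  let ?I = "\<lambda>k. if k < n then {-R..R} else {0}"
  have "x k \<in> ?I k \<longleftrightarrow> (k < n \<longrightarrow> \<bar>x k\<bar> \<le> R) \<and> (n \<le> k \<longrightarrow> x k = 0)" for x k
    by auto
  then have "cube n R = PiE UNIV ?I"
    unfolding cube_def PiE_UNIV_domain Pi_def by blast
  moreover have "compactin (powertop_real UNIV) (PiE UNIV ?I)"
    unfolding compactin_PiE by simp
  ultimately show ?thesis
    by (simp add: euclidean_product_topology)
qed

lemma trop_prevariety_cube_homotopy_equivalent:
  assumes "trop_system n A"
  obtains R where
    "top_of_set (trop_prevariety n A \<inter> cube n R)
       homotopy_equivalent_space top_of_set (trop_prevariety n A)"
proof -
  let ?V = "trop_prevariety n A" and ?E = "topspace (Euclidean_space n)"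
  have "finite (\<Union>A)"
    using assms by (auto simp: trop_system_def trop_poly_in_def)
  then obtain R and h :: "real \<times> (nat \<Rightarrow> real) \<Rightarrow> nat \<Rightarrow> real" where
    h_cont: "continuous_on ({0..1} \<times> ?E) h" and
    h_space: "\<And>t x. t \<in> {0..1} \<Longrightarrow> x \<in> ?E \<Longrightarrow> h (t, x) \<in> ?E" and
    h_start: "\<And>x. h (0, x) = x" and
    h_final: "\<And>x k. x \<in> ?E \<Longrightarrow> k < n \<Longrightarrow> \<bar>h (1, x) k\<bar> \<le> R" and
    h_cube: "\<And>t x k. \<lbrakk>t \<in> {0..1}; x \<in> ?E; k < n; \<bar>x k\<bar> \<le> R\<rbrakk> \<Longrightarrow> \<bar>h (t, x) k\<bar> \<le> R" and
    h_cell: "\<And>t x Q Q'. \<lbrakk>t \<in> {0..1}; x \<in> ?E; Q \<in> \<Union>A; Q' \<in> \<Union>A;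
         monomial_eval n Q x \<le> monomial_eval n Q' x\<rbrakk>
       \<Longrightarrow> monomial_eval n Q (h (t, x)) \<le> monomial_eval n Q' (h (t, x))"
    by (rule cell_preserving_contraction[of _ n]) (rule that)
  have VE: "?V \<subseteq> ?E"
    by (auto simp: trop_prevariety_def)
  (* The monomials that are minimal at x stay minimal along the motion. *)
  have V: "h (t, x) \<in> ?V" if t: "t \<in> {0..1}" and x: "x \<in> ?V" for t x
  proof -
    have "trop_zero n f (h (t, x))" if f: "f \<in> A" for f
    proof -
      have "finite f"
        using assms f by (auto simp: trop_system_def trop_poly_in_def)
      moreover have "trop_zero n f x"
        using x f by (auto simp: trop_prevariety_def)
      ultimately show ?thesis
        using h_cell[OF t] f x VE unfolding trop_zero_iff[OF \<open>finite f\<close>] by (meson UnionI subsetD)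
    qed
    then show ?thesis
      using h_space[OF t] x VE by (auto simp: trop_prevariety_def)
  qed
  have cube: "h (t, x) \<in> cube n R" if "t \<in> {0..1}" "x \<in> ?E" "x \<in> cube n R" for t x
    using that h_cube[OF that(1,2)] h_space[OF that(1,2)]
    by (auto simp: cube_def topspace_Euclidean_space)
  have final: "h (1, x) \<in> cube n R" if "x \<in> ?E" for x
    using h_final[OF that] h_space[of 1, OF _ that] by (auto simp: cube_def topspace_Euclidean_space)
  show thesis
  proof (rule that[of R], rule homotopy_equivalent_space_weak_deformation[of _ h])
    show "continuous_on ({0..1} \<times> ?V) h"
      by (rule continuous_on_subset[OF h_cont]) (use VE in auto)
  qed (use V VE cube final h_start in auto)
qed

section \<open>Expressing the cube by tropical polynomials\<close>

definition var :: "nat \<Rightarrow> nat \<Rightarrow> nat" where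
  "var k = (\<lambda>i. if i = k then 1 else 0)"

definition vars :: "trop_poly \<Rightarrow> nat set" where
  "vars f = {i. \<exists>Q\<in>f. snd Q i \<noteq> 0}"

definition copy_poly :: "nat \<Rightarrow> nat \<Rightarrow> trop_poly" where
  "copy_poly n k = {(0, var k), (0, var (n + k))}"

definition upper_poly :: "real \<Rightarrow> nat \<Rightarrow> nat \<Rightarrow> trop_poly" where
  "upper_poly R n k = {(0, var k), (0, var (n + k)), (R, \<lambda>_. 0)}"

definition neg_poly :: "nat \<Rightarrow> nat \<Rightarrow> trop_poly" where
  "neg_poly n k = {(0, \<lambda>i. var k i + var (2 * n + k) i), (0, \<lambda>_. 0)}"

text \<open>
  A third monomial bounds the common value of two others only from above. For a lower bound on \<open>x\<close>
  the two must therefore have a value independent of \<open>x\<close>, with \<open>x + R\<close> as the third; since \<open>-x\<close>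
  is not a monomial, the variable \<open>z\<close> provides the pair \<open>x + z\<close>, \<open>0\<close>.
\<close>

definition lower_poly :: "real \<Rightarrow> nat \<Rightarrow> nat \<Rightarrow> trop_poly" where
  "lower_poly R n k = {(0, \<lambda>i. var k i + var (2 * n + k) i), (0, \<lambda>_. 0), (R, var k)}"

definition cube_system :: "real \<Rightarrow> nat \<Rightarrow> trop_poly set" where
  "cube_system R n = copy_poly n ` {..<n} \<union> upper_poly R n ` {..<n}
     \<union> (neg_poly n ` {..<n} \<union> lower_poly R n ` {..<n})"

lemma var_distinct:
  "var k = var l \<longleftrightarrow> k = l"
  "var k \<noteq> (\<lambda>_. 0)" "(\<lambda>_. 0) \<noteq> var k"
  "(\<lambda>i. var k i + var l i) \<noteq> (\<lambda>_. 0)"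
  "(\<lambda>i. var k i + var l i) \<noteq> var m"
proof -
  show "var k = var l \<longleftrightarrow> k = l"
    by (auto simp: var_def fun_eq_iff split: if_splits)
  show "var k \<noteq> (\<lambda>_. 0)" "(\<lambda>_. 0) \<noteq> var k" "(\<lambda>i. var k i + var l i) \<noteq> (\<lambda>_. 0)"
    by (auto simp: var_def fun_eq_iff)
  (* The two sides differ in total degree; it suffices to look at the indices k and l. *)
  have "var k i + var l i = var m i \<Longrightarrow> i = k \<or> i = l \<Longrightarrow> i = m \<and> k \<noteq> l" for i
    by (auto simp: var_def split: if_splits)
  then show "(\<lambda>i. var k i + var l i) \<noteq> var m"
    by (metis (no_types))
qed

lemma vars_cube_polys:
  "vars (copy_poly n k) = {k, n + k}"
  "vars (upper_poly R n k) = {k, n + k}"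
  "vars (neg_poly n k) = {k, 2 * n + k}"
  "vars (lower_poly R n k) = {k, 2 * n + k}"
  by (auto simp: vars_def copy_poly_def upper_poly_def neg_poly_def lower_poly_def var_def
      split: if_splits)

lemma card_cube_polys:
  assumes "0 < n"
  shows "card (copy_poly n k) = 2" "card (upper_poly R n k) = 3"
    "card (neg_poly n k) = 2" "card (lower_poly R n k) = 3"
  using assms
  by (auto simp: copy_poly_def upper_poly_def neg_poly_def lower_poly_def var_distinct)

text \<open>
  The polynomials are told apart by their variables and their numbers of monomials.
\<close>

lemma card_cube_system: "card (cube_system R n) = 4 * n"
proof (cases "n = 0")
  case False
  have family: "card (g ` {..<n}) = n" if "\<And>k. vars (g k) = {k, c + k}" "c \<ge> n" for g c
  proof -
    have "inj_on g {..<n}"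
    proof (rule inj_onI)
      fix k l assume "k \<in> {..<n}" "l \<in> {..<n}" "g k = g l"
      moreover from \<open>g k = g l\<close> have "{k, c + k} = {l, c + l}"
        using that(1) by metis
      ultimately show "k = l"
        using that(2) by (auto simp: doubleton_eq_iff)
    qed
    then show ?thesis
      by (simp add: card_image)
  qed
  have "card (copy_poly n ` {..<n} \<union> upper_poly R n ` {..<n}) = n + n"
    "card (neg_poly n ` {..<n} \<union> lower_poly R n ` {..<n}) = n + n"
  proof -
    have "copy_poly n k \<noteq> upper_poly R n l" "neg_poly n k \<noteq> lower_poly R n l" for k l
      using card_cube_polys[of n] False
      by (metis neq0_conv numeral_eq_iff semiring_norm(89))+
    then show "card (copy_poly n ` {..<n} \<union> upper_poly R n ` {..<n}) = n + n"
      "card (neg_poly n ` {..<n} \<union> lower_poly R n ` {..<n}) = n + n"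
      using family[of "copy_poly n" n] family[of "upper_poly R n" n]
        family[of "neg_poly n" "2 * n"] family[of "lower_poly R n" "2 * n"]
      by (subst card_Un_disjoint; auto simp: vars_cube_polys)+
  qed
  moreover have "(copy_poly n ` {..<n} \<union> upper_poly R n ` {..<n})
      \<inter> (neg_poly n ` {..<n} \<union> lower_poly R n ` {..<n}) = {}"
  proof -
    have "f \<noteq> g" if "vars f = {k, n + k}" "vars g = {l, 2 * n + l}" "k < n" "l < n" for f g k l
    proof
      assume "f = g"
      then show False
        using that by (auto simp: doubleton_eq_iff)
    qed
    then show ?thesis
      by (fastforce simp: vars_cube_polys)
  qed
  ultimately show ?thesis
    unfolding cube_system_def by (subst card_Un_disjoint) auto
qed (simp add: cube_system_def)

lemma trop_system_cube_system: "trop_system (3 * n) (cube_system R n)"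
proof -
  have "trop_poly_in (3 * n) f"
    if "f \<in> {copy_poly n k, upper_poly R n k, neg_poly n k, lower_poly R n k}" "k < n" for f k
    using that
    by (auto simp: trop_poly_in_def copy_poly_def upper_poly_def neg_poly_def lower_poly_def
        var_distinct var_distinct(4,5)[THEN not_sym])
      (auto simp: var_def)
  then show ?thesis
    by (auto simp: trop_system_def cube_system_def)
qed

lemma trop_poly_in_mono:
  assumes "trop_poly_in n f" "n \<le> m"
  shows "trop_poly_in m f"
  using assms by (auto simp: trop_poly_in_def)

lemma disjoint_cube_system:
  assumes "trop_system n A"
  shows "A \<inter> cube_system R n = {}"
proof -
  have "vars f \<subseteq> {..<n}" if "f \<in> A" for f
    using assms that by (force simp: trop_system_def trop_poly_in_def vars_def not_less[symmetric])
  moreover have "\<not> vars f \<subseteq> {..<n}" if "f \<in> cube_system R n" for f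
    using that by (auto simp: cube_system_def vars_cube_polys)
  ultimately show ?thesis
    by blast
qed

lemma trop_zero_two:
  assumes "Q \<noteq> Q'"
  shows "trop_zero n {Q, Q'} x \<longleftrightarrow> monomial_eval n Q x = monomial_eval n Q' x"
  using assms by (subst trop_zero_iff) auto

text \<open>
  If two of three monomials agree, the minimum is attained twice unless the third is strictly smaller:
  this is how a tropical equation encodes an inequality.
\<close>

lemma trop_zero_three:
  assumes "Q \<noteq> Q'" "monomial_eval n Q x = monomial_eval n Q' x" "S \<noteq> Q"
  shows "trop_zero n {Q, Q', S} x \<longleftrightarrow> monomial_eval n Q x \<le> monomial_eval n S x"
  using assms by (subst trop_zero_iff) auto

lemma monomial_eval_var [simp]: "monomial_eval m (a, var k) x = a + (if k < m then x k else 0)"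
proof -
  have "(\<Sum>i<m. real (var k i) * x i) = (\<Sum>i<m. if i = k then x i else 0)"
    by (intro sum.cong) (auto simp: var_def)
  then show ?thesis
    by (simp add: monomial_eval_def)
qed

lemma monomial_eval_add:
  "monomial_eval m (a + b, \<lambda>i. e i + e' i) x = monomial_eval m (a, e) x + monomial_eval m (b, e') x"
  by (simp add: monomial_eval_def distrib_right sum.distrib)

lemma monomial_eval_const [simp]: "monomial_eval m (a, \<lambda>_. 0) x = a"
  by (simp add: monomial_eval_def)

lemma trop_zero_cube_polys:
  assumes "k < n"
  shows "trop_zero (3 * n) (copy_poly n k) x \<and> trop_zero (3 * n) (upper_poly R n k) x
      \<and> trop_zero (3 * n) (neg_poly n k) x \<and> trop_zero (3 * n) (lower_poly R n k) x
    \<longleftrightarrow> x (n + k) = x k \<and> x (2 * n + k) = - x k \<and> \<bar>x k\<bar> \<le> R"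
proof -
  have ev: "monomial_eval (3 * n) (0, \<lambda>i. var k i + var (2 * n + k) i) x = x k + x (2 * n + k)"
    using assms monomial_eval_add[of "3 * n" 0 0 "var k" "var (2 * n + k)" x] by simp
  have copy: "trop_zero (3 * n) (copy_poly n k) x \<longleftrightarrow> x (n + k) = x k"
    using assms unfolding copy_poly_def by (subst trop_zero_two) (auto simp: var_distinct)
  have upper: "trop_zero (3 * n) (upper_poly R n k) x \<longleftrightarrow> x k \<le> R" if "x (n + k) = x k"
    using assms that unfolding upper_poly_def by (subst trop_zero_three) (auto simp: var_distinct)
  have neg: "trop_zero (3 * n) (neg_poly n k) x \<longleftrightarrow> x (2 * n + k) = - x k"
    unfolding neg_poly_def by (subst trop_zero_two) (auto simp: var_distinct ev)
  have lower: "trop_zero (3 * n) (lower_poly R n k) x \<longleftrightarrow> - R \<le> x k" if "x (2 * n + k) = - x k"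
    using assms that unfolding lower_poly_def
    by (subst trop_zero_three) (auto simp: var_distinct var_distinct(4,5)[THEN not_sym] ev)
  show ?thesis
    using copy upper neg lower by (auto simp: abs_le_iff)
qed

section \<open>The compact prevariety\<close>

definition graph_point :: "nat \<Rightarrow> (nat \<Rightarrow> real) \<Rightarrow> nat \<Rightarrow> real" where
  "graph_point n x = (\<lambda>i. if i < n then x i else if i < 2 * n then x (i - n)
     else if i < 3 * n then - x (i - 2 * n) else 0)"

definition truncation :: "nat \<Rightarrow> (nat \<Rightarrow> real) \<Rightarrow> nat \<Rightarrow> real" where
  "truncation n x = (\<lambda>i. if i < n then x i else 0)"

lemma continuous_on_coordinate: "continuous_on S (\<lambda>x::nat \<Rightarrow> real. x k)"
  by (rule continuous_on_product_then_coordinatewise[OF continuous_on_id])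

lemma continuous_on_graph_point: "continuous_on S (graph_point n)"
proof (rule continuous_on_coordinatewise_then_product)
  fix i
  consider "i < n" | "\<not> i < n" "i < 2 * n" | "\<not> i < n" "\<not> i < 2 * n" "i < 3 * n" | "\<not> i < 3 * n"
    by linarith
  then show "continuous_on S (\<lambda>x. graph_point n x i)"
    by cases (auto simp: graph_point_def intro: continuous_on_coordinate continuous_on_minus)
qed

lemma continuous_on_truncation: "continuous_on S (truncation n)"
proof (rule continuous_on_coordinatewise_then_product)
  fix i
  show "continuous_on S (\<lambda>x. truncation n x i)"
    by (cases "i < n") (auto simp: truncation_def intro: continuous_on_coordinate)
qed

lemma monomial_eval_truncation:
  assumes "\<forall>k\<ge>n. snd Q k = 0" "n \<le> m"
  shows "monomial_eval m Q x = monomial_eval n Q (truncation n x)"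
proof -
  have "(\<Sum>k<m. real (snd Q k) * x k) = (\<Sum>k<n. real (snd Q k) * x k)"
    using assms by (intro sum.mono_neutral_right) auto
  also have "\<dots> = (\<Sum>k<n. real (snd Q k) * truncation n x k)"
    by (intro sum.cong) (auto simp: truncation_def)
  finally show ?thesis
    by (simp add: monomial_eval_def)
qed

lemma trop_zero_truncation:
  assumes "trop_poly_in n f" "n \<le> m"
  shows "trop_zero m f x \<longleftrightarrow> trop_zero n f (truncation n x)"
proof -
  have "\<And>Q. Q \<in> f \<Longrightarrow> monomial_eval m Q x = monomial_eval n Q (truncation n x)"
    using assms monomial_eval_truncation by (auto simp: trop_poly_in_def)
  moreover have "finite f"
    using assms by (simp add: trop_poly_in_def)
  ultimately show ?thesis
    by (simp add: trop_zero_iff)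
qed

lemma truncation_graph_point:
  assumes "x \<in> topspace (Euclidean_space n)"
  shows "truncation n (graph_point n x) = x"
  using assms by (auto simp: truncation_def graph_point_def topspace_Euclidean_space)

lemma trop_prevariety_cube_system:
  assumes "trop_system n A"
  shows "trop_prevariety (3 * n) (A \<union> cube_system R n)
    = graph_point n ` (trop_prevariety n A \<inter> cube n R)"
    (is "?W = graph_point n ` ?K")
proof -
  have A: "trop_zero (3 * n) f x \<longleftrightarrow> trop_zero n f (truncation n x)" if "f \<in> A" for f x
    using assms that by (intro trop_zero_truncation) (auto simp: trop_system_def)
  have W: "x \<in> ?W \<longleftrightarrow> (\<forall>i\<ge>3*n. x i = 0) \<and> (\<forall>f\<in>A. trop_zero n f (truncation n x)) \<and>
      (\<forall>k<n. x (n + k) = x k \<and> x (2 * n + k) = - x k \<and> \<bar>x k\<bar> \<le> R)" for x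
  proof -
    have "(\<forall>f\<in>cube_system R n. trop_zero (3 * n) f x) \<longleftrightarrow>
        (\<forall>k<n. x (n + k) = x k \<and> x (2 * n + k) = - x k \<and> \<bar>x k\<bar> \<le> R)"
      using trop_zero_cube_polys[of _ n x R] unfolding cube_system_def by blast
    then show ?thesis
      by (simp add: trop_prevariety_def topspace_Euclidean_space ball_Un A)
  qed
  show ?thesis
  proof (intro equalityI subsetI)
    fix x assume x: "x \<in> ?W"
    have "x = graph_point n (truncation n x)"
    proof
      fix i
      consider "i < n" | "n \<le> i" "i < 2 * n" | "2 * n \<le> i" "i < 3 * n" | "3 * n \<le> i"
        by linarith
      moreover have "x i = x (i - n)" if "n \<le> i" "i < 2 * n"
        using x that unfolding W by (metis add_diff_inverse_nat less_diff_conv2 linorder_not_less mult_2)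
      moreover have "x i = - x (i - 2 * n)" if "2 * n \<le> i" "i < 3 * n"
      proof -
        have "i - 2 * n < n" "i = 2 * n + (i - 2 * n)"
          using that by auto
        then show ?thesis
          using x unfolding W by metis
      qed
      ultimately show "x i = graph_point n (truncation n x) i"
        using x unfolding W by cases (auto simp: graph_point_def truncation_def)
    qed
    moreover have "truncation n x \<in> ?K"
      using x unfolding W
      by (auto simp: trop_prevariety_def topspace_Euclidean_space cube_def truncation_def)
    ultimately show "x \<in> graph_point n ` ?K"
      by blast
  next
    fix y assume "y \<in> graph_point n ` ?K"
    then obtain x where x: "x \<in> ?K" and y: "y = graph_point n x"
      by blast
    then have "truncation n y = x"
      by (auto simp: truncation_graph_point trop_prevariety_def)
    then show "y \<in> ?W"
      using x y unfolding W by (auto simp: trop_prevariety_def cube_def graph_point_def)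
  qed
qed

lemma subtopology_Euclidean_space:
  assumes "S \<subseteq> topspace (Euclidean_space n)"
  shows "subtopology (Euclidean_space n) S = top_of_set S"
  using assms
  by (simp add: Euclidean_space_def subtopology_subtopology euclidean_product_topology
      Int_absorb1)

theorem theorem9p2:
  fixes n :: nat and A :: "trop_poly set" and V :: "(nat \<Rightarrow> real) set"
  assumes "trop_system n A"
    and "V = trop_prevariety n A"
  shows "\<exists>C B W. trop_system (3 * n) C \<and> card C = 4 * n \<and> A \<inter> C = {} \<and>
           B = A \<union> C \<and> trop_system (3 * n) B \<and>
           W = trop_prevariety (3 * n) B \<and>
           compactin (Euclidean_space (3 * n)) W \<and>
           subtopology (Euclidean_space (3 * n)) W
             homotopy_equivalent_space subtopology (Euclidean_space n) V"
proof -
  obtain R where R: "top_of_set (V \<inter> cube n R) homotopy_equivalent_space top_of_set V"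
    using trop_prevariety_cube_homotopy_equivalent[OF assms(1)] assms(2) by blast
  define K where "K = V \<inter> cube n R"
  define C where "C = cube_system R n"
  define W where "W = trop_prevariety (3 * n) (A \<union> C)"
  have W: "W = graph_point n ` K"
    using trop_prevariety_cube_system[OF assms(1)] by (simp add: W_def C_def K_def assms(2))
  have V_space: "V \<subseteq> topspace (Euclidean_space n)"
    and W_space: "W \<subseteq> topspace (Euclidean_space (3 * n))"
    by (auto simp: assms(2) W_def trop_prevariety_def)
  have "compact K"
    unfolding K_def assms(2) using closed_trop_prevariety[OF assms(1)] compact_cube
    by (rule closed_Int_compact)
  then have "compact W"
    unfolding W by (intro compact_continuous_image continuous_on_graph_point)
  then have compact: "compactin (Euclidean_space (3 * n)) W"
    using W_space
    by (simp add: Euclidean_space_def compactin_subtopology euclidean_product_topology)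
  have "homeomorphic_maps (top_of_set W) (top_of_set K) (truncation n) (graph_point n)"
    unfolding homeomorphic_maps_def using V_space
    by (auto simp: W K_def truncation_graph_point subset_iff
        intro: continuous_on_graph_point continuous_on_truncation)
  then have "top_of_set W homotopy_equivalent_space top_of_set K"
    using homeomorphic_imp_homotopy_equivalent_space homeomorphic_space_def by blast
  then have "top_of_set W homotopy_equivalent_space top_of_set V"
    using R homotopy_eqv_trans unfolding K_def by blast
  then have "subtopology (Euclidean_space (3 * n)) W
      homotopy_equivalent_space subtopology (Euclidean_space n) V"
    using V_space W_space by (simp add: subtopology_Euclidean_space)
  moreover have "trop_system (3 * n) C"
    unfolding C_def by (rule trop_system_cube_system)
  moreover from this have "trop_system (3 * n) (A \<union> C)"
    using assms(1) trop_poly_in_mono[of n _ "3 * n"] by (auto simp: trop_system_def)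
  moreover have "card C = 4 * n" "A \<inter> C = {}"
    unfolding C_def using card_cube_system disjoint_cube_system[OF assms(1)] by auto
  ultimately show ?thesis
    using compact W_def by blast
qed

end
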